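(* For any integer $n>24$, any $d>r$ (where $r>0$ is the range of transmission and $d$ is the Geocast eccentricity), any integers $\alpha\ge 0$, $\beta>0$, any $V_{\max}>\pi r/(6\alpha)$, and any fair randomized Geocast protocol $\mathcal{P}$, there exists an $(\alpha,\beta)$-connected MANET of $n$ nodes (node speeds bounded by $V_{\max}$) for which, in order to solve the problem with probability at least $2^{-n/2}$, $\mathcal{P}$ takes at least $$\frac{\alpha n}{2}+\frac{n^2}{96\ln(n/2)}$$ time slots.
   Context: **Model.** A MANET is a set $V$ of $n$ nodes in $\mathbb{R}^2$, no two at the same point at the same time. Time is divided into slots $1,2,\dots$; positions (hence topology) change only at slot boundaries, and no node moves faster than $V_{\max}$ (measured as distance per time slot). All nodes have the same range of transmission $r>0$; two nodes are neighbors in a slot if their distance is at most $r$ during the whole slot. An active node $u$ receives a transmission from a neighbor $v$ in a slot if and only if $v$ is the only node transmitting in that slot among $u$ and its neighbors. There is no collision detection. Nodes may be activated at any slot boundary, and may fail (become inactive) and be reactivated; upon activation a node starts its algorithm from scratch, keeping no state. Slots counted from a node's activation are its (local) steps. **Geocast.** A source node $s$ holds a piece of information $I$ at time $t_1$. $I$ must be delivered to all nodes that at time $t_1$ are active and located within distance $d$ (the eccentricity) of the position of $s$ at that time. A node is covered if it has received $I$ (the source counts as covered from $t_1$), otherwise uncovered. A node is informed at time $t$ if it holds $I$ at time $t$. The problem is solved at slot $t_2\ge t_1$ if all target nodes are covered by slot $t_2$; the time taken is counted in slots from $t_1$. **$(\alpha,\beta)$-connectivity** (integers $\alpha\ge0$,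 $\beta\ge1$). For every slot $t\ge t_1$ at which the problem is not yet solved there is a slot $t'$ such that $[t,t+\alpha]\cap[t',t'+\beta)\neq\emptyset$, and there are nodes $p,p'$ such that at time $t'$ $p$ is informed and $p'$ is uncovered, and $p,p'$ are active and neighbors from step $t'$ until $p'$ becomes covered or until step $t'+\beta-1$ (inclusive), whichever occurs first. **Adversary.** Placement, movement and activation schedule (and the instance: source and $t_1$) are chosen by an adaptive adversary, which decides at the end of each slot with access to the protocol and all nodes' internal states but not to future random bits, subject to the speed bound and $(\alpha,\beta)$-connectivity. "There exists an $(\alpha,\beta)$-connected MANET" means that there is such an adversary strategy. Probability is over the protocol's random bits. **Protocols.** Protocols are conditional: a node does not transmit before it is covered. A randomized protocol is fair if in every execution and every (global) time slot all covered nodes transmit with the same probability (this common probability may depend on the slot and on the execution). For $\alpha=0$ the quantity $\pi r/(6\alpha)$ is read as $+\infty$ (here $\pi$ is the circle constant). *)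

theory Defs
  imports "HOL-Probability.Probability" "HOL-Probability.Product_PMF"
begin

text \<open>
  Nodes are the numbers below \<open>n\<close>; slots are numbered from 1, and ``time \<open>t\<close>'' is the beginning of
  slot \<open>t\<close>. A packet is a flag telling whether the information \<open>I\<close> is included, together with
  arbitrary further content.

  \<open>activate v\<close> is the state in which node \<open>v\<close> starts after every activation (in particular it knows
  no global clock), and \<open>hand_over\<close> is applied to the source when it is given \<open>I\<close>. In each slot an
  active node draws its private random bits and decides whether to transmit (\<open>act\<close>); at the end of
  the slot it processes what it has received (\<open>hear\<close>).
\<close>

type_synonym 'm packet = "bool \<times> 'm"

record ('s, 'm) protocol =
  activate :: "nat \<Rightarrow> 's"
  hand_over :: "nat \<Rightarrow> 's \<Rightarrow> 's"
  act :: "nat \<Rightarrow> 's \<Rightarrow> ('m packet option \<times> 's) pmf"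
  hear :: "nat \<Rightarrow> 's \<Rightarrow> 'm packet option \<Rightarrow> 's"

text \<open>
  The record of one slot. Being covered is permanent, whereas a node that fails loses \<open>I\<close> with its
  state and is then no longer informed. The field \<open>states\<close> is meaningful for active nodes only.
\<close>

record 's slot_record =
  position :: "nat \<Rightarrow> real^2"
  active :: "nat set"
  informed_start :: "nat set"
  covered_start :: "nat set"
  states :: "nat \<Rightarrow> 's"  \<comment> \<open>at the end of the slot\<close>
  informed_end :: "nat set"
  covered_end :: "nat set"

text \<open>
  At every slot boundary the adversary sees the records of all past slots (oldest first) and fixes
  the positions and the set of active nodes for the next slot.
\<close>

record 's adversary =
  source :: nat
  t_one :: nat
  strategy :: "'s slot_record list \<Rightarrow> (nat \<Rightarrow> real^2) \<times> nat set"

definition neighbors :: "real \<Rightarrow> (nat \<Rightarrow> real^2) \<Rightarrow> nat \<Rightarrow> nat \<Rightarrow> bool" where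
  "neighbors r pos u v \<longleftrightarrow> u \<noteq> v \<and> dist (pos u) (pos v) \<le> r"


text \<open>The situation at the beginning of the slot that follows the history \<open>h\<close>.\<close>

definition next_positions :: "'s adversary \<Rightarrow> 's slot_record list \<Rightarrow> nat \<Rightarrow> real^2" where
  "next_positions adv h = fst (strategy adv h)"

definition next_active :: "'s adversary \<Rightarrow> 's slot_record list \<Rightarrow> nat set" where
  "next_active adv h = snd (strategy adv h)"

definition next_informed :: "'s adversary \<Rightarrow> 's slot_record list \<Rightarrow> nat set" where
  "next_informed adv h =
     (if h = [] then {} else informed_end (last h) \<inter> next_active adv h) \<union>
     (if Suc (length h) = t_one adv then {source adv} else {})"

definition next_covered :: "'s adversary \<Rightarrow> 's slot_record list \<Rightarrow> nat set" where
  "next_covered adv h =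
     (if h = [] then {} else covered_end (last h)) \<union>
     (if Suc (length h) = t_one adv then {source adv} else {})"

definition next_state ::
    "('s, 'm) protocol \<Rightarrow> 's adversary \<Rightarrow> 's slot_record list \<Rightarrow> nat \<Rightarrow> 's" where
  "next_state P adv h v =
     (let \<sigma> = (if h \<noteq> [] \<and> v \<in> active (last h) then states (last h) v else activate P v)
      in if Suc (length h) = t_one adv \<and> v = source adv then hand_over P v \<sigma> else \<sigma>)"

definition transmission_prob ::
    "('s, 'm) protocol \<Rightarrow> 's adversary \<Rightarrow> 's slot_record list \<Rightarrow> nat \<Rightarrow> real" where
  "transmission_prob P adv h v =
     measure_pmf.prob (act P v (next_state P adv h v)) {x. fst x \<noteq> None}"


text \<open>
  Communication in one slot, where \<open>A\<close> is the set of active nodes and \<open>tx v\<close> is the packet sent by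
  \<open>v\<close>, if any.
\<close>

definition receives_from ::
    "real \<Rightarrow> (nat \<Rightarrow> real^2) \<Rightarrow> nat set \<Rightarrow> (nat \<Rightarrow> 'm packet option) \<Rightarrow> nat \<Rightarrow> nat \<Rightarrow> bool" where
  "receives_from r pos A tx u v \<longleftrightarrow>
     u \<in> A \<and> neighbors r pos u v \<and>
     {w \<in> A. tx w \<noteq> None \<and> (w = u \<or> neighbors r pos u w)} = {v}"

definition received ::
    "real \<Rightarrow> (nat \<Rightarrow> real^2) \<Rightarrow> nat set \<Rightarrow> (nat \<Rightarrow> 'm packet option) \<Rightarrow> nat \<Rightarrow> 'm packet option" where
  "received r pos A tx u =
     (if \<exists>v. receives_from r pos A tx u v then tx (THE v. receives_from r pos A tx u v) else None)"

text \<open>A packet can only include \<open>I\<close> if its sender holds \<open>I\<close>.\<close>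

definition newly_informed ::
    "real \<Rightarrow> (nat \<Rightarrow> real^2) \<Rightarrow> nat set \<Rightarrow> nat set \<Rightarrow> (nat \<Rightarrow> 'm packet option) \<Rightarrow> nat set" where
  "newly_informed r pos A informed tx =
     {u. \<exists>v\<in>informed. receives_from r pos A tx u v \<and> (\<exists>m. tx v = Some (True, m))}"

definition finish_slot ::
    "real \<Rightarrow> ('s, 'm) protocol \<Rightarrow> 's adversary \<Rightarrow> 's slot_record list \<Rightarrow>
     (nat \<Rightarrow> 'm packet option \<times> 's) \<Rightarrow> 's slot_record" where
  "finish_slot r P adv h \<omega> =
     (let pos = next_positions adv h; A = next_active adv h; tx = (\<lambda>v. fst (\<omega> v));
          new = newly_informed r pos A (next_informed adv h) tx
      in \<lparr>position = pos, active = A,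
          informed_start = next_informed adv h, covered_start = next_covered adv h,
          states = (\<lambda>v. hear P v (snd (\<omega> v)) (received r pos A tx v)),
          informed_end = next_informed adv h \<union> new, covered_end = next_covered adv h \<union> new\<rparr>)"

definition slot_pmf ::
    "real \<Rightarrow> ('s, 'm) protocol \<Rightarrow> 's adversary \<Rightarrow> 's slot_record list \<Rightarrow> 's slot_record pmf" where
  "slot_pmf r P adv h =
     map_pmf (finish_slot r P adv h)
       (Pi_pmf (next_active adv h) (None, undefined) (\<lambda>v. act P v (next_state P adv h v)))"

text \<open>The distribution of the records of slots \<open>1, \<dots>, k\<close>.\<close>

primrec run_pmf ::
    "real \<Rightarrow> ('s, 'm) protocol \<Rightarrow> 's adversary \<Rightarrow> nat \<Rightarrow> 's slot_record list pmf" where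
  "run_pmf r P adv 0 = return_pmf []"
| "run_pmf r P adv (Suc k) =
     bind_pmf (run_pmf r P adv k) (\<lambda>h. map_pmf (\<lambda>c. h @ [c]) (slot_pmf r P adv h))"

text \<open>Infinite executions; \<open>e t\<close> is the record of slot \<open>t\<close>, and \<open>e 0\<close> is irrelevant.\<close>

definition execution ::
    "real \<Rightarrow> ('s, 'm) protocol \<Rightarrow> 's adversary \<Rightarrow> (nat \<Rightarrow> 's slot_record) \<Rightarrow> bool" where
  "execution r P adv e \<longleftrightarrow> (\<forall>k. map e [1..<Suc k] \<in> set_pmf (run_pmf r P adv k))"


definition targets :: "real \<Rightarrow> 's adversary \<Rightarrow> (nat \<Rightarrow> 's slot_record) \<Rightarrow> nat set" where
  "targets d adv e =
     {v \<in> active (e (t_one adv)).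
        dist (position (e (t_one adv)) v) (position (e (t_one adv)) (source adv)) \<le> d}"

text \<open>The problem is solved at time \<open>t\<close>, that is, after the \<open>t - t\<^sub>1\<close> slots \<open>t\<^sub>1, \<dots>, t - 1\<close>.\<close>

definition solved_at :: "real \<Rightarrow> 's adversary \<Rightarrow> (nat \<Rightarrow> 's slot_record) \<Rightarrow> nat \<Rightarrow> bool" where
  "solved_at d adv e t \<longleftrightarrow> targets d adv e \<subseteq> covered_start (e t)"

definition prob_solved_at ::
    "real \<Rightarrow> real \<Rightarrow> ('s, 'm) protocol \<Rightarrow> 's adversary \<Rightarrow> nat \<Rightarrow> real" where
  "prob_solved_at r d P adv t =
     measure_pmf.prob (run_pmf r P adv t) {h. solved_at d adv (\<lambda>i. h ! (i - 1)) t}"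


definition legal_adversary ::
    "nat \<Rightarrow> real \<Rightarrow> real \<Rightarrow> ('s, 'm) protocol \<Rightarrow> 's adversary \<Rightarrow> bool" where
  "legal_adversary n r Vmax P adv \<longleftrightarrow>
     source adv < n \<and> 1 \<le> t_one adv \<and>
     (\<forall>k. \<forall>h\<in>set_pmf (run_pmf r P adv k).
        next_active adv h \<subseteq> {..<n} \<and>
        inj_on (next_positions adv h) {..<n} \<and>
        (h \<noteq> [] \<longrightarrow> (\<forall>v<n. dist (position (last h) v) (next_positions adv h v) \<le> Vmax)) \<and>
        (Suc k = t_one adv \<longrightarrow> source adv \<in> next_active adv h))"

text \<open>The slot in which \<open>p'\<close> becomes covered still belongs to the period of adjacency.\<close>

definition alpha_beta_connected ::
    "nat \<Rightarrow> real \<Rightarrow> real \<Rightarrow> nat \<Rightarrow> nat \<Rightarrow> ('s, 'm) protocol \<Rightarrow> 's adversary \<Rightarrow> bool" where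
  "alpha_beta_connected n r d \<alpha> \<beta> P adv \<longleftrightarrow>
     (\<forall>e. execution r P adv e \<longrightarrow>
       (\<forall>t\<ge>t_one adv. \<not> solved_at d adv e t \<longrightarrow>
         (\<exists>t'\<ge>1. {t..t + \<alpha>} \<inter> {t'..<t' + \<beta>} \<noteq> {} \<and>
           (\<exists>p<n. \<exists>p'<n. p \<in> informed_start (e t') \<and> p' \<notin> covered_start (e t') \<and>
             (\<forall>s\<in>{t'..<t' + \<beta>}. p' \<notin> covered_start (e s) \<longrightarrow>
                p \<in> active (e s) \<and> p' \<in> active (e s) \<and> neighbors r (position (e s)) p p')))))"

definition connected_MANET ::
    "nat \<Rightarrow> real \<Rightarrow> real \<Rightarrow> real \<Rightarrow> nat \<Rightarrow> nat \<Rightarrow> ('s, 'm) protocol \<Rightarrow> 's adversary \<Rightarrow> bool" where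
  "connected_MANET n r d Vmax \<alpha> \<beta> P adv \<longleftrightarrow>
     legal_adversary n r Vmax P adv \<and> alpha_beta_connected n r d \<alpha> \<beta> P adv"

definition conditional_protocol ::
    "nat \<Rightarrow> real \<Rightarrow> real \<Rightarrow> real \<Rightarrow> nat \<Rightarrow> nat \<Rightarrow> ('s, 'm) protocol \<Rightarrow> bool" where
  "conditional_protocol n r d Vmax \<alpha> \<beta> P \<longleftrightarrow>
     (\<forall>adv k. connected_MANET n r d Vmax \<alpha> \<beta> P adv \<longrightarrow>
       (\<forall>h\<in>set_pmf (run_pmf r P adv k). \<forall>v\<in>next_active adv h - next_covered adv h.
          transmission_prob P adv h v = 0))"

text \<open>
  Fairness compares the nodes that currently hold \<open>I\<close>. A covered node that has failed and been
  reactivated is in the same state as one that has never been covered, so including such nodes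
  would force all nodes of a conditional protocol to be silent.
\<close>

definition fair_protocol ::
    "nat \<Rightarrow> real \<Rightarrow> real \<Rightarrow> real \<Rightarrow> nat \<Rightarrow> nat \<Rightarrow> ('s, 'm) protocol \<Rightarrow> bool" where
  "fair_protocol n r d Vmax \<alpha> \<beta> P \<longleftrightarrow>
     (\<forall>adv k. connected_MANET n r d Vmax \<alpha> \<beta> P adv \<longrightarrow>
       (\<forall>h\<in>set_pmf (run_pmf r P adv k). \<forall>u\<in>next_informed adv h. \<forall>v\<in>next_informed adv h.
          transmission_prob P adv h u = transmission_prob P adv h v))"

definition speed_threshold :: "real \<Rightarrow> nat \<Rightarrow> ereal" where
  "speed_threshold r \<alpha> = (if \<alpha> = 0 then \<infinity> else ereal (pi * r / (6 * real \<alpha>)))"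

end

theory Submission
  imports Defs
begin

text \<open>
  The adversary lets the nodes \<open>0, 1, \<dots>\<close> be covered one by one. After the first slot it keeps the uncovered ones inactive
  until it is their turn, which comes after \<open>\<alpha>\<close> slots without any contact. Old informed nodes sit
  near \<open>x = 0\<close>, uncovered nodes near \<open>x = r\<close>, and the node covered last has meanwhile moved halfway,
  to \<open>x = r / 2\<close>, so that it is a neighbor of the next uncovered node wherever the latter goes near
  \<open>x = r\<close>. Hence a minute step of the uncovered node decides whether it hears only one or all of the
  \<open>k\<close> informed nodes. By fairness they all transmit with the same probability \<open>p\<close>, which the adversary
  knows in advance; if \<open>p\<close> is small it chooses the single neighbor, and otherwise it provokes a
  collision. Once half of the nodes are covered, each slot with contact thus succeeds with probability
  at most \<open>\<theta> = O(ln n / n)\<close>, and an exponential supermartingale bounds the probability that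
  \<open>n\<^sup>2 / (96 ln (n / 2))\<close> such slots suffice for the other half.
\<close>

section \<open>The chance of a unique transmitter\<close>

text \<open>The left-hand side is the chance that exactly one of \<open>k\<close> independent nodes
  transmits. It decays essentially like \<open>exp (- k * p)\<close>, where \<open>k * p\<close>
  exceeds \<open>4 * ln m\<close>.\<close>

lemma one_transmitter_prob_le:
  fixes m p :: real and k :: nat
  assumes "12 \<le> m" "m \<le> real k" "4 * ln m / m < p" "p \<le> 1"
  shows "real k * (p * (1 - p) ^ (k - 1)) \<le> 4 * ln m / m"
proof -
  have ln1: "1 \<le> ln m"
    using assms(1) exp_le by (subst ln_ge_iff) auto
  have p0: "0 < p"
    using assms(1,3) ln1 by (smt (verit) divide_nonneg_pos)
  have "(1 - p) ^ (k - 1) \<le> exp (- p) ^ (k - 1)"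
    using assms(4) exp_ge_add_one_self[of "- p"] by (intro power_mono) auto
  also have "\<dots> = exp (- (p * real (k - 1)))"
    by (simp flip: exp_of_nat_mult add: mult.commute)
  also have "\<dots> \<le> exp (- (3 / 4 * (real k * p)))"
  proof -
    have "3 / 4 * real k \<le> real (k - 1)"
      using assms(1,2) by (simp add: of_nat_diff)
    from mult_right_mono[OF this, of p] p0 show ?thesis by (simp add: mult_ac)
  qed
  finally have pw: "(1 - p) ^ (k - 1) \<le> exp (- (3 / 4 * (real k * p)))" .
  \<comment> \<open>Passing from \<open>k - 1\<close> to \<open>k\<close> has cost a quarter of the
    exponent; another quarter absorbs the factor \<open>k * p\<close>, and the remaining half still
    yields \<open>4 / m ^ 2\<close>.\<close>
  have kp: "real k * p \<le> 4 * exp (real k * p / 4)"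
    using exp_ge_add_one_self[of "real k * p / 4"] by linarith
  have "real k * (p * (1 - p) ^ (k - 1)) = (real k * p) * (1 - p) ^ (k - 1)"
    by simp
  also have "\<dots> \<le> (4 * exp (real k * p / 4)) * exp (- (3 / 4 * (real k * p)))"
    by (rule mult_mono[OF kp pw]) (use assms(4) in auto)
  also have "\<dots> = 4 * exp (- (real k * p / 2))"
    by (simp flip: exp_add)
  also have "\<dots> \<le> 4 * exp (- (2 * ln m))"
  proof -
    have "4 * ln m \<le> m * p"
      using assms(1,3) by (simp add: field_simps)
    also have "\<dots> \<le> real k * p"
      using assms(2) p0 by (intro mult_right_mono) auto
    finally show ?thesis by simp
  qed
  also have "\<dots> = 4 / m\<^sup>2"
  proof -
    have "exp (2 * ln m) = m\<^sup>2"
      using assms(1) exp_of_nat_mult[of 2 "ln m"] by simp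
    then show ?thesis by (simp add: exp_minus field_simps)
  qed
  also have "\<dots> \<le> 4 * ln m / m"
  proof -
    have "1 \<le> ln m * m"
      using mult_mono[of 1 "ln m" 1 m] ln1 assms(1) by simp
    then show ?thesis
      using assms(1) by (simp add: field_simps power2_eq_square)
  qed
  finally show ?thesis .
qed

text \<open>
  Every node moves along its own horizontal line, which keeps the positions distinct; all lines lie
  within a strip of width \<open>\<epsilon>\<close>, so that only the abscissas matter.
\<close>

definition point :: "real \<Rightarrow> real \<Rightarrow> real^2" where
  "point x y = vector [x, y]"

lemma dist_point: "dist (point x y) (point x' y') = sqrt ((x - x')\<^sup>2 + (y - y')\<^sup>2)"
  by (simp add: point_def dist_vec_def L2_set_def sum_2 dist_real_def)

lemma dist_point_le: "dist (point x y) (point x' y') \<le> \<bar>x - x'\<bar> + \<bar>y - y'\<bar>"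
  unfolding dist_point by (rule sqrt_sum_squares_le_sum_abs)

lemma dist_point_ge: "\<bar>x - x'\<bar> \<le> dist (point x y) (point x' y')"
  unfolding dist_point by (rule real_sqrt_ge_abs1)

section \<open>Statistics of a history\<close>

text \<open>The value \<open>{0}\<close> on the empty history reflects that the adversary below has
  source 0 and \<open>t_one = 1\<close>.\<close>

definition covered_after :: "'s slot_record list \<Rightarrow> nat set" where
  "covered_after h = (if h = [] then {0} else covered_end (last h))"

definition level :: "'s slot_record list \<Rightarrow> nat" where
  "level h = card (covered_after h)"

definition idle_time :: "'s slot_record list \<Rightarrow> nat" where
  "idle_time h = length (takeWhile (\<lambda>c. covered_end c = covered_start c) (rev h))"

lemma covered_after_Nil [simp]: "covered_after [] = {0}"
  and covered_after_snoc [simp]: "covered_after (h @ [c]) = covered_end c"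
  by (auto simp: covered_after_def)

lemma idle_time_Nil [simp]: "idle_time [] = 0"
  and idle_time_snoc [simp]:
    "idle_time (h @ [c]) = (if covered_end c = covered_start c then Suc (idle_time h) else 0)"
  by (auto simp: idle_time_def)

section \<open>The adversary and its invariant\<close>

text \<open>\<open>4 * \<epsilon> \<le> r\<close> keeps \<open>r / 2\<close> within reach of both
  \<open>r - \<epsilon>\<close> and \<open>r + \<epsilon>\<close>;
  \<open>r + 2 * \<epsilon> \<le> d\<close> makes every node a target;
  \<open>2 * \<epsilon> \<le> V\<close> permits a switch between these two abscissas in one slot,
  and \<open>speed\<close> a walk of length \<open>r / 2\<close> in \<open>\<alpha>\<close>
  slots.\<close>

locale one_by_one_adversary =
  fixes n \<alpha> \<beta> :: nat and r d V \<epsilon> :: real and P :: "('s, 'm) protocol"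
  assumes n: "n > 24" and alpha: "\<alpha> \<ge> 1" and eps: "\<epsilon> > 0" "4 * \<epsilon> \<le> r" "r + 2 * \<epsilon> \<le> d" "2 * \<epsilon> \<le> V"
    and speed: "r / (2 * real \<alpha>) \<le> V" and beta: "\<beta> > 0"
    and fair: "fair_protocol n r d V \<alpha> \<beta> P"
begin

definition \<theta> :: real where
  "\<theta> = 4 * ln (real n / 2) / (real n / 2)"

text \<open>The prospective transmission probability does not depend on the field \<open>strategy\<close>, so a
  dummy breaks the circularity in the definition of the adversary.\<close>

definition near :: "'s slot_record list \<Rightarrow> bool" where
  "near h \<longleftrightarrow> \<alpha> \<le> idle_time h \<and>
     \<theta> < transmission_prob P \<lparr>source = 0, t_one = 1, strategy = \<lambda>_. (\<lambda>_. 0, {})\<rparr> h 0"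

definition contact :: "'s slot_record list \<Rightarrow> bool" where
  "contact h \<longleftrightarrow> \<alpha> \<le> idle_time h \<and> level h < n"

definition shift :: "'s slot_record list \<Rightarrow> real" where
  "shift h = real (min (idle_time h) \<alpha>) / real \<alpha> * (r / 2)"

text \<open>While the next node waits, the last covered node slides from \<open>r\<close> to
  \<open>r / 2\<close> and its predecessor from \<open>r / 2\<close> to 0. The source starts at 0,
  so its slide to \<open>r / 2\<close> goes to the right.\<close>

definition abscissa :: "'s slot_record list \<Rightarrow> nat \<Rightarrow> real" where
  "abscissa h v =
     (if v + 2 < level h then 0
      else if v + 2 = level h then r / 2 - shift h
      else if v + 1 = level h then (if v = 0 then shift h else r - shift h)
      else if v = level h \<and> near h then r - \<epsilon>
      else r + \<epsilon>)"

definition node_position :: "'s slot_record list \<Rightarrow> nat \<Rightarrow> real^2" where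
  "node_position h v = point (abscissa h v) (real v * (\<epsilon> / real n))"

text \<open>All nodes are active in slot 1 in order to be targets; at abscissa
  \<open>r + \<epsilon>\<close> the uncovered ones are then out of reach of the source. Covered
  nodes never fail.\<close>

definition active_nodes :: "'s slot_record list \<Rightarrow> nat set" where
  "active_nodes h =
     (if h = [] then {..<n} else if contact h then {..level h} else {..<level h})"

definition adv :: "'s adversary" where
  "adv = \<lparr>source = 0, t_one = 1, strategy = \<lambda>h. (node_position h, active_nodes h)\<rparr>"

definition well_formed :: "'s slot_record list \<Rightarrow> bool" where
  "well_formed h \<longleftrightarrow> covered_after h = {..<level h} \<and> 1 \<le> level h \<and> level h \<le> n \<and>
     (h \<noteq> [] \<longrightarrow> informed_end (last h) = covered_end (last h))"

lemma adv_simps [simp]: "source adv = 0" "t_one adv = Suc 0"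
  "next_positions adv h = node_position h" "next_active adv h = active_nodes h"
  by (simp_all add: adv_def next_positions_def next_active_def)

lemma next_covered_adv [simp]: "next_covered adv h = covered_after h"
  by (simp add: next_covered_def covered_after_def)

lemma level_Nil [simp]: "level [] = 1"
  by (simp add: level_def)

lemma well_formed_Nil: "well_formed []"
  using n by (auto simp: well_formed_def)

lemma r_pos: "r > 0"
  using eps by linarith

lemma contact_nonempty: "contact h \<Longrightarrow> h \<noteq> []"
  using alpha by (auto simp: contact_def)

lemma near_iff: "near h \<longleftrightarrow> \<alpha> \<le> idle_time h \<and> \<theta> < transmission_prob P adv h 0"
  by (simp add: near_def adv_def transmission_prob_def next_state_def)

lemma covered_subset_active: "well_formed h \<Longrightarrow> covered_after h \<subseteq> active_nodes h"
  by (auto simp: well_formed_def active_nodes_def)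

lemma active_nodes_subset: "well_formed h \<Longrightarrow> active_nodes h \<subseteq> {..<n}"
  by (auto simp: well_formed_def active_nodes_def contact_def)

lemma next_informed_adv:
  assumes "well_formed h"
  shows "next_informed adv h = covered_after h"
  using assms covered_subset_active[OF assms]
  by (auto simp: next_informed_def covered_after_def well_formed_def)

section \<open>Neighborhoods under the placement\<close>

lemma height_diff: "u < n \<Longrightarrow> v < n \<Longrightarrow> \<bar>real u * (\<epsilon> / real n) - real v * (\<epsilon> / real n)\<bar> \<le> \<epsilon>"
proof -
  assume "u < n" "v < n"
  then have "\<bar>real u - real v\<bar> \<le> real n" by linarith
  then have "\<bar>real u - real v\<bar> * (\<epsilon> / real n) \<le> real n * (\<epsilon> / real n)"
    using eps by (intro mult_right_mono) auto
  moreover have "\<bar>real u * (\<epsilon> / real n) - real v * (\<epsilon> / real n)\<bar> = \<bar>real u - real v\<bar> * (\<epsilon> / real n)"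
    using eps by (simp only: abs_mult flip: left_diff_distrib) simp
  ultimately show ?thesis
    using n by simp
qed

lemma inj_node_position: "inj_on (node_position h) A"
proof (rule inj_onI)
  fix u v assume "node_position h u = node_position h v"
  then have "node_position h u $ 2 = node_position h v $ 2" by simp
  then show "u = v"
    using eps n by (simp add: node_position_def point_def)
qed

lemma neighborsI:
  assumes "u < n" "v < n" "u \<noteq> v" "\<bar>abscissa h u - abscissa h v\<bar> + \<epsilon> \<le> r"
  shows "neighbors r (node_position h) u v"
  using dist_point_le[of "abscissa h u" "real u * (\<epsilon> / real n)" "abscissa h v" "real v * (\<epsilon> / real n)"]
    height_diff[OF assms(1,2)] assms(3,4)
  unfolding neighbors_def node_position_def by linarith

lemma neighborsD: "neighbors r (node_position h) u v \<Longrightarrow> \<bar>abscissa h u - abscissa h v\<bar> \<le> r"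
  using dist_point_ge[of "abscissa h u" "abscissa h v" "real u * (\<epsilon> / real n)" "real v * (\<epsilon> / real n)"]
  unfolding neighbors_def node_position_def by linarith

lemma shift_contact: "\<alpha> \<le> idle_time h \<Longrightarrow> shift h = r / 2"
  using alpha by (simp add: shift_def)

lemma shift_fresh: "idle_time h = 0 \<Longrightarrow> shift h = 0"
  by (simp add: shift_def)

lemma shift_Suc:
  assumes "idle_time h' = Suc (idle_time h)"
  shows "shift h \<le> shift h'" "shift h' \<le> shift h + V"
proof -
  have "shift h' = shift h + (if idle_time h < \<alpha> then r / (2 * real \<alpha>) else 0)"
    using alpha assms by (auto simp: shift_def field_simps min_def)
  then show "shift h \<le> shift h'" "shift h' \<le> shift h + V"
    using speed r_pos eps by auto
qed

lemma contact_neighbors: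
  assumes "well_formed h" "contact h"
  shows "neighbors r (node_position h) (level h) (level h - 1)"
proof (rule neighborsI)
  show "\<bar>abscissa h (level h) - abscissa h (level h - 1)\<bar> + \<epsilon> \<le> r"
    using assms eps shift_contact[of h]
    by (auto simp: abscissa_def well_formed_def contact_def)
  show "level h < n" "level h - 1 < n" "level h \<noteq> level h - 1"
    using assms unfolding well_formed_def contact_def by linarith+
qed

lemma near_neighbors:
  assumes "well_formed h" "contact h" "near h" "v < level h"
  shows "neighbors r (node_position h) (level h) v"
proof (rule neighborsI)
  show "\<bar>abscissa h (level h) - abscissa h v\<bar> + \<epsilon> \<le> r"
    using assms eps shift_contact[of h]
    by (auto simp: abscissa_def well_formed_def contact_def)
qed (use assms in \<open>auto simp: well_formed_def contact_def\<close>)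

lemma far_neighbors:
  assumes "well_formed h" "contact h" "\<not> near h" "v < level h"
    and "neighbors r (node_position h) (level h) v"
  shows "v = level h - 1"
proof (rule ccontr)
  assume "v \<noteq> level h - 1"
  then have "abscissa h v = 0"
    using assms(2,4) shift_contact[of h] by (auto simp: abscissa_def contact_def)
  moreover have "abscissa h (level h) = r + \<epsilon>"
    using assms(3) by (simp add: abscissa_def)
  ultimately show False
    using neighborsD[OF assms(5)] eps r_pos by auto
qed

section \<open>The effect of one slot, and legality of the adversary\<close>

text \<open>Only an active uncovered node can become covered. After slot 1 the only candidate is
  node \<open>level h\<close>, and only during contact; in slot 1 no node is in reach of the
  source.\<close>

lemma covered_end_finish_slot:
  assumes "well_formed h"
  shows "covered_end (finish_slot r P adv h \<omega>) =
    (if contact h \<and> level h \<in>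
        newly_informed r (node_position h) (active_nodes h) (covered_after h) (\<lambda>v. fst (\<omega> v))
     then {..level h} else {..<level h})"
proof -
  define new where
    "new = newly_informed r (node_position h) (active_nodes h) (covered_after h) (\<lambda>v. fst (\<omega> v))"
  have cov: "covered_after h = {..<level h}"
    using assms by (simp add: well_formed_def)
  have 1: "covered_end (finish_slot r P adv h \<omega>) = {..<level h} \<union> new"
    by (simp add: finish_slot_def Let_def next_informed_adv[OF assms] new_def cov)
  have act: "new \<subseteq> active_nodes h"
    by (auto simp: new_def newly_informed_def receives_from_def)
  consider "h = []" | "h \<noteq> []" "contact h" | "h \<noteq> []" "\<not> contact h" by blast
  then show ?thesis
  proof cases
    case 1
    have "new = {}"
    proof (rule ccontr)
      assume "new \<noteq> {}"
      then obtain u where "neighbors r (node_position h) u 0"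
        by (auto simp: new_def newly_informed_def receives_from_def \<open>h = []\<close>)
      moreover from this have "u \<noteq> 0" by (auto simp: neighbors_def)
      ultimately have "\<bar>abscissa h u - abscissa h 0\<bar> \<le> r"
        using neighborsD by blast
      with \<open>u \<noteq> 0\<close> show False
        using eps r_pos alpha by (auto simp: \<open>h = []\<close> abscissa_def shift_fresh near_def)
    qed
    then show ?thesis
      using \<open>covered_end _ = _\<close> contact_nonempty 1 by auto
  next
    case 2
    then show ?thesis
      using 1 act unfolding new_def[symmetric]
      by (auto simp: active_nodes_def lessThan_Suc simp flip: lessThan_Suc_atMost)
  next
    case 3
    then show ?thesis
      using 1 act unfolding new_def[symmetric] by (auto simp: active_nodes_def)
  qed
qed

lemma finish_slot_simps:
  assumes "well_formed h"
  shows "position (finish_slot r P adv h \<omega>) = node_position h"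
    "active (finish_slot r P adv h \<omega>) = active_nodes h"
    "informed_start (finish_slot r P adv h \<omega>) = {..<level h}"
    "covered_start (finish_slot r P adv h \<omega>) = {..<level h}"
    "informed_end (finish_slot r P adv h \<omega>) = covered_end (finish_slot r P adv h \<omega>)"
  using assms
  by (simp_all add: finish_slot_def Let_def next_informed_adv[OF assms]) (simp_all add: well_formed_def)

lemma set_pmf_slot:
  assumes "c \<in> set_pmf (slot_pmf r P adv h)"
  obtains \<omega> where "c = finish_slot r P adv h \<omega>"
  using assms by (auto simp: slot_pmf_def)

definition advances :: "'s slot_record list \<Rightarrow> 's slot_record list \<Rightarrow> bool" where
  "advances h h' \<longleftrightarrow> level h' = level h \<and> idle_time h' = Suc (idle_time h) \<or>
     contact h \<and> level h' = Suc (level h) \<and> idle_time h' = 0"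

lemma slot_step:
  assumes "well_formed h" "c \<in> set_pmf (slot_pmf r P adv h)"
  shows "well_formed (h @ [c])" "advances h (h @ [c])"
    "position c = node_position h" "active c = active_nodes h"
    "informed_start c = {..<level h}" "covered_start c = {..<level h}"
proof -
  obtain \<omega> where c: "c = finish_slot r P adv h \<omega>"
    using assms(2) by (rule set_pmf_slot)
  have cs: "covered_start c = {..<level h}"
    using finish_slot_simps[OF assms(1)] by (simp add: c)
  have ce: "covered_end c = {..<level h} \<or> contact h \<and> covered_end c = {..level h}"
    unfolding c covered_end_finish_slot[OF assms(1)] by auto
  have lev: "level (h @ [c]) = card (covered_end c)"
    by (simp add: level_def)
  show "advances h (h @ [c])"
    using ce by (auto simp: advances_def lev cs)
  have "informed_end c = covered_end c"
    using finish_slot_simps(5)[OF assms(1)] by (simp add: c)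
  then show "well_formed (h @ [c])"
    using ce assms(1) by (auto simp: well_formed_def lev contact_def lessThan_Suc_atMost)
  show "position c = node_position h" "active c = active_nodes h"
    "informed_start c = {..<level h}" "covered_start c = {..<level h}"
    using finish_slot_simps[OF assms(1)] by (simp_all add: c)
qed

lemma run_well_formed: "h \<in> set_pmf (run_pmf r P adv k) \<Longrightarrow> well_formed h \<and> length h = k"
proof (induction k arbitrary: h)
  case (Suc k)
  then show ?case using slot_step(1) by auto
qed (simp add: well_formed_Nil)

lemma speed_ok:
  assumes "well_formed h" "advances h h'"
  shows "dist (node_position h v) (node_position h' v) \<le> V"
proof -
  have "\<bar>abscissa h v - abscissa h' v\<bar> \<le> V"
    using assms(2) unfolding advances_def
  proof (elim disjE conjE)
    assume "level h' = level h" "idle_time h' = Suc (idle_time h)"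
    then show ?thesis
      using shift_Suc[of h' h] eps by (auto simp: abscissa_def)
  next
    \<comment> \<open>The roles change without a jump: the abscissas \<open>r / 2\<close> and 0 are
      the same before and after, and only the newly covered node moves, by \<open>\<epsilon>\<close>
      to \<open>r\<close>.\<close>
    assume *: "contact h" "level h' = Suc (level h)" "idle_time h' = 0"
    then have "\<not> near h'" "shift h' = 0" "shift h = r / 2"
      using alpha by (auto simp: near_def shift_fresh shift_contact contact_def)
    then show ?thesis
      using * assms(1) eps by (auto simp: abscissa_def well_formed_def)
  qed
  then show ?thesis
    using dist_point_le[of "abscissa h v" "real v * (\<epsilon> / real n)" "abscissa h' v" "real v * (\<epsilon> / real n)"]
    by (simp add: node_position_def)
qed

lemma legal: "legal_adversary n r V P adv"
  unfolding legal_adversary_def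
proof (intro conjI allI ballI impI)
  fix k h assume h: "h \<in> set_pmf (run_pmf r P adv k)"
  then have wf: "well_formed h" using run_well_formed by blast
  show "next_active adv h \<subseteq> {..<n}"
    using active_nodes_subset[OF wf] by simp
  show "inj_on (next_positions adv h) {..<n}"
    by (simp add: inj_node_position)
  show "source adv \<in> next_active adv h"
    using covered_subset_active[OF wf] wf by (auto simp: well_formed_def)
  fix v assume "h \<noteq> []"
  then obtain k' where "k = Suc k'"
    using run_well_formed[OF h] by (cases k) auto
  then obtain h' c where h': "h = h' @ [c]" "h' \<in> set_pmf (run_pmf r P adv k')"
    "c \<in> set_pmf (slot_pmf r P adv h')"
    using h by auto
  have wf': "well_formed h'" using run_well_formed h'(2) by blast
  show "dist (position (last h) v) (next_positions adv h v) \<le> V"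
    using speed_ok[OF wf' slot_step(2)[OF wf' h'(3)]] slot_step(3)[OF wf' h'(3)]
    by (simp add: h'(1))
qed (use n in auto)

section \<open>Targets and connectivity\<close>

lemma targets_adv:
  assumes "position (e 1) = node_position []" "active (e 1) = active_nodes []"
  shows "targets d adv e = {..<n}"
proof -
  have "dist (node_position [] v) (node_position [] 0) \<le> d" if "v < n" for v
  proof -
    have "\<bar>abscissa [] v - abscissa [] 0\<bar> \<le> r + \<epsilon>"
      using eps r_pos alpha by (auto simp: abscissa_def near_def shift_fresh)
    moreover have "\<bar>real v * (\<epsilon> / real n) - 0\<bar> \<le> \<epsilon>"
      using height_diff[of v 0] that n by simp
    ultimately show ?thesis
      using dist_point_le[of "abscissa [] v" "real v * (\<epsilon> / real n)" "abscissa [] 0" 0] eps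
      unfolding node_position_def by auto
  qed
  then show ?thesis
    using assms by (auto simp: targets_def active_nodes_def)
qed

text \<open>The witnesses are the last covered node and the next one. Once in contact, they remain
  neighbors until the latter is covered, however large \<open>\<beta>\<close> is.\<close>

lemma connected: "alpha_beta_connected n r d \<alpha> \<beta> P adv"
  unfolding alpha_beta_connected_def
proof (intro allI impI)
  fix e t
  assume ex: "execution r P adv e" and t: "t_one adv \<le> t" and ns: "\<not> solved_at d adv e t"
  define H where "H s = map e [1..<s]" for s
  have H_run: "H s \<in> set_pmf (run_pmf r P adv (s - 1))" for s
    using ex[unfolded execution_def, rule_format, of "s - 1"]
    by (cases s) (auto simp: H_def)
  then have wf: "well_formed (H s)" for s
    using run_well_formed by blast
  have H_Suc: "H (Suc s) = H s @ [e s]" if "s \<ge> 1" for s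
    using that by (simp add: H_def)
  have slot: "e s \<in> set_pmf (slot_pmf r P adv (H s))" if "s \<ge> 1" for s
  proof -
    have "H (Suc s) \<in> set_pmf (run_pmf r P adv (Suc (s - 1)))"
      using H_run[of "Suc s"] that by simp
    then show ?thesis
      unfolding H_Suc[OF that] by auto
  qed
  note step = slot_step[OF wf slot]
  have adv_step: "advances (H s) (H (Suc s))" if "s \<ge> 1" for s
    using step(2)[OF that] H_Suc[OF that] by simp
  have "H 1 = []" by (simp add: H_def)
  then have tg: "targets d adv e = {..<n}"
    using step(3,4)[of 1] by (intro targets_adv) auto
  have t1: "t \<ge> 1" using t by simp
  let ?k = "level (H t)"
  have kn: "?k < n"
    using ns tg step(6)[OF t1] by (auto simp: solved_at_def)
  \<comment> \<open>Node \<open>?k\<close> cannot be covered before the \<open>\<alpha>\<close> idle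
    slots are complete.\<close>
  have later: "level (H (t + i)) > ?k \<and> i > \<alpha> - idle_time (H t) \<or>
      level (H (t + i)) = ?k \<and> idle_time (H (t + i)) = idle_time (H t) + i" for i
  proof (induction i)
    case (Suc i)
    then show ?case
      using adv_step[of "t + i"] t1 by (auto simp: advances_def contact_def)
  qed simp
  \<comment> \<open>By truncated subtraction \<open>t'\<close> is \<open>t\<close> itself if contact
    already exists, and otherwise the first slot with contact, at most \<open>\<alpha>\<close> slots
    later.\<close>
  define t' where "t' = t + (\<alpha> - idle_time (H t))"
  have t'1: "t' \<ge> 1" using t1 by (simp add: t'_def)
  have lev': "level (H t') = ?k"
    using later[of "\<alpha> - idle_time (H t)"] by (auto simp: t'_def)
  have adj: "?k - 1 \<in> active (e s) \<and> ?k \<in> active (e s) \<and> neighbors r (position (e s)) (?k - 1) ?k"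
    if "t' \<le> s" "?k \<notin> covered_start (e s)" for s
  proof -
    have s1: "s \<ge> 1" using that t'1 by simp
    define i where "i = s - t"
    have s: "s = t + i" "i \<ge> \<alpha> - idle_time (H t)"
      using that by (auto simp: i_def t'_def)
    have "level (H s) = ?k" "idle_time (H s) = idle_time (H t) + i"
      using later[of i] that(2) step(6)[OF s1] by (auto simp: s(1))
    then have "contact (H s)" "level (H s) = ?k"
      using s(2) kn by (auto simp: contact_def)
    then show ?thesis
      using contact_neighbors[OF wf, of s] contact_nonempty step(3,4)[OF s1] wf[of s]
      by (auto simp: active_nodes_def neighbors_def dist_commute well_formed_def)
  qed
  show "\<exists>t'\<ge>1. {t..t + \<alpha>} \<inter> {t'..<t' + \<beta>} \<noteq> {} \<and>
      (\<exists>p<n. \<exists>p'<n. p \<in> informed_start (e t') \<and> p' \<notin> covered_start (e t') \<and>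
        (\<forall>s\<in>{t'..<t' + \<beta>}. p' \<notin> covered_start (e s) \<longrightarrow>
          p \<in> active (e s) \<and> p' \<in> active (e s) \<and> neighbors r (position (e s)) p p'))"
  proof (rule exI[of _ t'], intro conjI)
    show "1 \<le> t'" by (rule t'1)
    have "t' \<in> {t..t + \<alpha>} \<inter> {t'..<t' + \<beta>}"
      using beta by (simp add: t'_def)
    then show "{t..t + \<alpha>} \<inter> {t'..<t' + \<beta>} \<noteq> {}" by blast
    have "?k - 1 \<in> informed_start (e t')" "?k \<notin> covered_start (e t')" "?k - 1 < n"
      using step(5,6)[OF t'1] lev' wf[of t] kn by (auto simp: well_formed_def)
    moreover have "\<forall>s\<in>{t'..<t' + \<beta>}. ?k \<notin> covered_start (e s) \<longrightarrow>
        ?k - 1 \<in> active (e s) \<and> ?k \<in> active (e s) \<and> neighbors r (position (e s)) (?k - 1) ?k"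
      using adj by simp
    ultimately show "\<exists>p<n. \<exists>p'<n. p \<in> informed_start (e t') \<and> p' \<notin> covered_start (e t') \<and>
        (\<forall>s\<in>{t'..<t' + \<beta>}. p' \<notin> covered_start (e s) \<longrightarrow>
          p \<in> active (e s) \<and> p' \<in> active (e s) \<and> neighbors r (position (e s)) p p')"
      using kn by blast
  qed
qed

section \<open>Success in a slot with contact\<close>

text \<open>Fairness is granted only in connected MANETs, so \<open>legal\<close> and
  \<open>connected\<close> have to come first. Covered nodes are informed here, so it applies to all
  of them.\<close>

lemma fair_transmission:
  assumes "h \<in> set_pmf (run_pmf r P adv k)" "v < level h"
  shows "transmission_prob P adv h v = transmission_prob P adv h 0"
proof -
  have wf: "well_formed h" using run_well_formed[OF assms(1)] by blast
  then have "v \<in> next_informed adv h" "0 \<in> next_informed adv h"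
    using assms(2) next_informed_adv[OF wf] by (auto simp: well_formed_def)
  then show ?thesis
    using fair legal connected assms(1)
    unfolding fair_protocol_def connected_MANET_def by blast
qed

lemma \<theta>_pos: "0 < \<theta>"
  using n by (simp add: \<theta>_def)

text \<open>With only one neighbor the chance is at most the transmission probability, which is then at
  most \<open>\<theta>\<close>; with all informed nodes as neighbors, a transmission probability above \<open>\<theta>\<close> makes a
  collision almost certain.\<close>

lemma success_prob_le:
  assumes h: "h \<in> set_pmf (run_pmf r P adv i)" and c: "contact h" and large: "n \<le> 2 * level h"
  shows "measure_pmf.prob (slot_pmf r P adv h) {c. level h \<in> covered_end c} \<le> \<theta>"
proof -
  have wf: "well_formed h" using run_well_formed[OF h] by blast
  define k where "k = level h"
  define Q where "Q v = act P v (next_state P adv h v)" for v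
  define M where "M = Pi_pmf {..k} (None, undefined) Q"
  define p where "p = transmission_prob P adv h 0"
  define T :: "('m packet option \<times> 's) set" where "T = {x. fst x \<noteq> None}"
  define S where "S = {\<omega> :: nat \<Rightarrow> 'm packet option \<times> 's. k \<in> newly_informed r (node_position h) {..k} {..<k} (\<lambda>v. fst (\<omega> v))}"
  have A: "active_nodes h = {..k}"
    using c contact_nonempty[OF c] by (simp add: active_nodes_def k_def)
  have pQ: "measure_pmf.prob (Q v) T = p" if "v < k" for v
    using fair_transmission[OF h, of v] that
    by (simp add: Q_def T_def p_def k_def transmission_prob_def)
  have pQ_compl: "measure_pmf.prob (Q v) (- T) = 1 - p" if "v < k" for v
    using measure_pmf.prob_compl[of T "Q v"] pQ[OF that] by (simp add: Compl_eq_Diff_UNIV)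
  have p01: "0 \<le> p" "p \<le> 1"
    by (simp_all add: p_def transmission_prob_def)
  have "measure_pmf.prob (slot_pmf r P adv h) {c. level h \<in> covered_end c} = measure_pmf.prob M S"
  proof -
    have "finish_slot r P adv h -` {c. level h \<in> covered_end c} = S"
      using c wf by (auto simp: covered_end_finish_slot[OF wf] S_def A k_def well_formed_def)
    then show ?thesis
      by (simp add: slot_pmf_def measure_map_pmf A M_def Q_def[abs_def])
  qed
  also have "\<dots> \<le> \<theta>"
  proof (cases "near h")
    case False
    have "S \<subseteq> (\<lambda>\<omega>. \<omega> (k - 1)) -` T"
      using far_neighbors[OF wf c False]
      by (fastforce simp: S_def newly_informed_def receives_from_def T_def k_def)
    then have "measure_pmf.prob M S \<le> measure_pmf.prob M ((\<lambda>\<omega>. \<omega> (k - 1)) -` T)"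
      by (intro measure_pmf.finite_measure_mono) auto
    also have "\<dots> = measure_pmf.prob (map_pmf (\<lambda>\<omega>. \<omega> (k - 1)) M) T"
      by (simp add: measure_map_pmf)
    also have "\<dots> = p"
      using wf by (simp add: M_def Pi_pmf_component pQ well_formed_def k_def)
    also have "\<dots> \<le> \<theta>"
      using False c by (simp add: near_iff contact_def p_def)
    finally show ?thesis .
  next
    case True
    \<comment> \<open>In \<open>Pi {..k} (B v)\<close> node \<open>v\<close> is the only transmitter
      among the informed nodes; the receiver \<open>k\<close> is left unconstrained and contributes
      a factor 1 to the product.\<close>
    define B where "B v w = (if w = k then UNIV else if w = v then T else - T)" for v w
    have "S \<subseteq> (\<Union>v<k. Pi {..k} (B v))"
    proof
      fix \<omega> assume "\<omega> \<in> S"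
      then obtain v where v: "v < k" and
        eq: "{w \<in> {..k}. fst (\<omega> w) \<noteq> None \<and> (w = k \<or> neighbors r (node_position h) k w)} = {v}"
        by (auto simp: S_def newly_informed_def receives_from_def)
      have "w = v \<longleftrightarrow> fst (\<omega> w) \<noteq> None" if "w < k" for w
      proof -
        have "neighbors r (node_position h) k w"
          using near_neighbors[OF wf c True] that by (simp add: k_def)
        moreover have "w \<in> {v} \<longleftrightarrow> w \<le> k \<and> fst (\<omega> w) \<noteq> None \<and> (w = k \<or> neighbors r (node_position h) k w)"
          unfolding eq[symmetric] by simp
        ultimately show ?thesis
          using that by simp
      qed
      then have "\<omega> \<in> Pi {..k} (B v)"
        by (auto simp: B_def T_def Pi_def)
      then show "\<omega> \<in> (\<Union>v<k. Pi {..k} (B v))"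
        using v by blast
    qed
    then have "measure_pmf.prob M S \<le> measure_pmf.prob M (\<Union>v<k. Pi {..k} (B v))"
      by (intro measure_pmf.finite_measure_mono) auto
    also have "\<dots> \<le> (\<Sum>v<k. measure_pmf.prob M (Pi {..k} (B v)))"
      by (intro measure_pmf.finite_measure_subadditive_finite) auto
    also have "\<dots> = (\<Sum>v<k. p * (1 - p) ^ (k - 1))"
    proof (intro sum.cong refl)
      fix v assume v: "v \<in> {..<k}"
      have "measure_pmf.prob M (Pi {..k} (B v)) = (\<Prod>w\<in>{..k}. measure_pmf.prob (Q w) (B v w))"
        by (simp add: M_def measure_Pi_pmf_Pi)
      also have "\<dots> = (\<Prod>w<k. measure_pmf.prob (Q w) (B v w))"
        by (simp add: B_def flip: lessThan_Suc_atMost)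
      also have "\<dots> = (\<Prod>w<k. if w = v then p else 1 - p)"
        using pQ pQ_compl by (intro prod.cong) (auto simp: B_def)
      also have "\<dots> = p * (\<Prod>w\<in>{..<k} - {v}. 1 - p)"
        using v by (subst prod.remove[of _ v]) (auto intro!: prod.cong)
      finally show "measure_pmf.prob M (Pi {..k} (B v)) = p * (1 - p) ^ (k - 1)"
        using v by simp
    qed
    also have "\<dots> = real k * (p * (1 - p) ^ (k - 1))"
      by simp
    also have "\<dots> \<le> \<theta>"
      unfolding \<theta>_def
      using True p01 n large
      by (intro one_transmitter_prob_le) (auto simp: near_iff p_def k_def \<theta>_def)
    finally show ?thesis .
  qed
  finally show ?thesis .
qed

section \<open>The exponential supermartingale\<close>

text \<open>Bounds the mean of a factor that is 4 with probability at most \<open>\<theta>\<close>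
  and 1 otherwise.\<close>

definition \<rho> :: real where
  "\<rho> = 1 + 3 * \<theta>"

text \<open>\<open>(level h - 1) * \<alpha> + min (idle_time h) \<alpha>\<close> is the number of past slots without contact, so the
  powers of \<open>\<rho>\<close> charge for the slots with contact; the truncated subtraction in the first exponent
  makes the coverings of the first half of the nodes free.\<close>

definition potential :: "'s slot_record list \<Rightarrow> real" where
  "potential h = 4 ^ (level h - (n + 1) div 2) *
     \<rho> ^ ((level h - 1) * \<alpha> + min (idle_time h) \<alpha>) / \<rho> ^ length h"

lemma \<rho>_ge_1: "1 \<le> \<rho>"
  using \<theta>_pos by (simp add: \<rho>_def)

lemma potential_pos: "0 < potential h"
  using \<rho>_ge_1 by (simp add: potential_def)

text \<open>During the first \<open>\<alpha>\<close> idle slots of a level both powers of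
  \<open>\<rho>\<close> grow alike and cancel. Every other slot gains a factor
  \<open>1 / \<rho>\<close>; a covering costs at most a factor 4, and nothing while
  \<open>2 * level h < n\<close>.\<close>

lemma
  assumes wf: "well_formed h" and a: "advances h h'" and len: "length h' = Suc (length h)"
  shows potential_advance: "\<not> (contact h \<and> n \<le> 2 * level h) \<Longrightarrow> potential h' \<le> potential h"
    and potential_contact: "contact h \<Longrightarrow>
      potential h' \<le> potential h / \<rho> * (if level h' = level h then 1 else 4)"
proof -
  let ?half = "(n + 1) div 2"
  \<comment> \<open>At a covering \<open>idle_time\<close> is reset, and the increase of
    \<open>level\<close> makes up for exactly the \<open>\<alpha>\<close> idle slots lost.\<close>
  have exponent: "(level h - 1) * \<alpha> + \<alpha> = level h * \<alpha>"
    using wf by (cases "level h") (auto simp: well_formed_def)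
  have up: "potential h' = 4 ^ (Suc (level h) - ?half) * (\<rho> ^ (level h * \<alpha>) / \<rho> ^ Suc (length h))"
    if "level h' = Suc (level h)" "idle_time h' = 0"
    using that by (simp add: potential_def len)
  have here: "potential h / \<rho> = 4 ^ (level h - ?half) * (\<rho> ^ (level h * \<alpha>) / \<rho> ^ Suc (length h))"
    if "contact h"
  proof -
    have "min (idle_time h) \<alpha> = \<alpha>" using that by (simp add: contact_def)
    then have "potential h = 4 ^ (level h - ?half) * \<rho> ^ (level h * \<alpha>) / \<rho> ^ length h"
      by (simp only: potential_def exponent)
    then show ?thesis by simp
  qed
  have same: "potential h' = potential h / \<rho>"
    if "\<alpha> \<le> idle_time h" "level h' = level h" "idle_time h' = Suc (idle_time h)"
  proof -
    have "min (idle_time h) \<alpha> = \<alpha>" "min (idle_time h') \<alpha> = \<alpha>" using that by auto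
    then show ?thesis by (simp add: potential_def that(2) len mult_ac)
  qed
  have le: "potential h / \<rho> \<le> potential h"
    using \<rho>_ge_1 potential_pos[of h] by (simp add: divide_le_eq)
  have nonneg: "0 \<le> \<rho> ^ (level h * \<alpha>) / \<rho> ^ Suc (length h)"
    using \<rho>_ge_1 by simp
  show "potential h' \<le> potential h / \<rho> * (if level h' = level h then 1 else 4)" if c: "contact h"
    using a unfolding advances_def
  proof (elim disjE conjE)
    assume "level h' = level h" "idle_time h' = Suc (idle_time h)"
    then show ?thesis using same c by (simp add: contact_def)
  next
    assume *: "level h' = Suc (level h)" "idle_time h' = 0"
    have "(4::real) ^ (Suc (level h) - ?half) \<le> 4 ^ Suc (level h - ?half)"
      by (rule power_increasing) auto
    from mult_right_mono[OF this nonneg] show ?thesis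
      unfolding up[OF *] here[OF c] using *(1) by (simp add: mult_ac)
  qed
  show "potential h' \<le> potential h" if small: "\<not> (contact h \<and> n \<le> 2 * level h)"
    using a unfolding advances_def
  proof (elim disjE conjE)
    assume *: "level h' = level h" "idle_time h' = Suc (idle_time h)"
    show ?thesis
    proof (cases "\<alpha> \<le> idle_time h")
      case True
      then show ?thesis using same[OF _ *] le by simp
    next
      case False
      then have "min (idle_time h') \<alpha> = Suc (min (idle_time h) \<alpha>)" using *(2) by simp
      then show ?thesis using \<rho>_ge_1 by (simp add: potential_def len *(1))
    qed
  next
    assume *: "contact h" "level h' = Suc (level h)" "idle_time h' = 0"
    then have "Suc (level h) - ?half = 0" "level h - ?half = 0"
      using small by auto
    then have "potential h' = potential h / \<rho>"
      unfolding up[OF *(2,3)] here[OF *(1)] by simp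
    then show ?thesis using le by simp
  qed
qed

text \<open>In the second half, the mean growth \<open>1 + 3 * ?q\<close> in a slot with contact is
  at most \<open>1 + 3 * \<theta> = \<rho>\<close>, which the division by \<open>\<rho>\<close>
  offsets.\<close>

lemma potential_step:
  assumes h: "h \<in> set_pmf (run_pmf r P adv k)"
  shows "(\<integral>\<^sup>+ c. ennreal (potential (h @ [c])) \<partial>slot_pmf r P adv h) \<le> ennreal (potential h)"
proof -
  have wf: "well_formed h" using run_well_formed[OF h] by blast
  note pa = potential_advance[OF wf slot_step(2)[OF wf]] potential_contact[OF wf slot_step(2)[OF wf]]
  show ?thesis
  proof (cases "contact h \<and> n \<le> 2 * level h")
    case False
    have "(\<integral>\<^sup>+ c. ennreal (potential (h @ [c])) \<partial>slot_pmf r P adv h) \<le>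
        (\<integral>\<^sup>+ c. ennreal (potential h) \<partial>slot_pmf r P adv h)"
      using pa(1)[OF _ _ False]
      by (intro nn_integral_mono_AE) (auto simp: AE_measure_pmf_iff intro!: ennreal_leI)
    then show ?thesis by simp
  next
    case True
    let ?S = "{c. level h \<in> covered_end c}"
    let ?q = "measure_pmf.prob (slot_pmf r P adv h) ?S"
    have "ennreal (potential (h @ [c])) \<le> ennreal (potential h / \<rho>) * (1 + 3 * indicator ?S c)"
      if c: "c \<in> set_pmf (slot_pmf r P adv h)" for c
    proof -
      have "well_formed (h @ [c])" by (rule slot_step(1)[OF wf c])
      then have "level (h @ [c]) = level h" if "level h \<notin> covered_end c"
        using that slot_step(2)[OF wf c] by (auto simp: well_formed_def advances_def)
      then have "potential (h @ [c]) \<le> potential h / \<rho> * (1 + 3 * indicator ?S c)"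
        using pa(2)[OF c] True potential_pos[of h] \<rho>_ge_1
        by (auto simp: indicator_def divide_simps split: if_splits)
      then have "ennreal (potential (h @ [c])) \<le> ennreal (potential h / \<rho> * (1 + 3 * indicator ?S c))"
        by (rule ennreal_leI)
      also have "\<dots> = ennreal (potential h / \<rho>) * (1 + 3 * indicator ?S c)"
        using potential_pos[of h] \<rho>_ge_1 by (subst ennreal_mult) (auto simp: indicator_def)
      finally show ?thesis .
    qed
    then have "(\<integral>\<^sup>+ c. ennreal (potential (h @ [c])) \<partial>slot_pmf r P adv h) \<le>
        (\<integral>\<^sup>+ c. ennreal (potential h / \<rho>) * (1 + 3 * indicator ?S c) \<partial>slot_pmf r P adv h)"
      by (intro nn_integral_mono_AE) (auto simp: AE_measure_pmf_iff)
    also have "\<dots> = ennreal (potential h / \<rho>) * (1 + 3 * ennreal ?q)"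
      by (simp add: nn_integral_cmult nn_integral_add measure_pmf.emeasure_eq_measure)
    also have "\<dots> = ennreal (potential h / \<rho> * (1 + 3 * ?q))"
      using potential_pos[of h] \<rho>_ge_1 by (subst ennreal_mult) (simp_all add: ennreal_mult)
    also have "\<dots> \<le> ennreal (potential h / \<rho> * \<rho>)"
      using success_prob_le[OF h] True potential_pos[of h] \<rho>_ge_1
      by (intro ennreal_leI mult_left_mono) (auto simp: \<rho>_def)
    also have "\<dots> = ennreal (potential h)"
      using \<rho>_ge_1 by simp
    finally show ?thesis .
  qed
qed

lemma potential_run: "(\<integral>\<^sup>+ h. ennreal (potential h) \<partial>run_pmf r P adv k) \<le> 1"
proof (induction k)
  case 0
  show ?case using n by (simp add: potential_def)
next
  case (Suc k)
  have "(\<integral>\<^sup>+ h. ennreal (potential h) \<partial>run_pmf r P adv (Suc k)) =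
      (\<integral>\<^sup>+ h. \<integral>\<^sup>+ c. ennreal (potential (h @ [c])) \<partial>slot_pmf r P adv h \<partial>run_pmf r P adv k)"
    by simp
  also have "\<dots> \<le> (\<integral>\<^sup>+ h. ennreal (potential h) \<partial>run_pmf r P adv k)"
    using potential_step by (intro nn_integral_mono_AE) (auto simp: AE_measure_pmf_iff)
  finally show ?case using Suc by simp
qed

section \<open>The time bound\<close>

lemma run_first_slot:
  assumes "h \<in> set_pmf (run_pmf r P adv (Suc k))"
  shows "position (h ! 0) = node_position [] \<and> active (h ! 0) = active_nodes []"
  using assms
proof (induction k arbitrary: h)
  case 0
  then show ?case using slot_step(3,4)[OF well_formed_Nil] by auto
next
  case (Suc k)
  then obtain h' c where h': "h = h' @ [c]" "h' \<in> set_pmf (run_pmf r P adv (Suc k))"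
    unfolding run_pmf.simps(2)[of _ _ _ "Suc k"] by (auto simp del: run_pmf.simps)
  then show ?case
    using Suc.IH[OF h'(2)] run_well_formed[OF h'(2)] by (simp add: nth_append)
qed

text \<open>Markov's inequality: the potential has mean at most 1, whereas solving the problem
  forces \<open>level h = n\<close> and with it a potential of at least
  \<open>1 / ?B\<close>.\<close>

lemma prob_solved_le:
  "prob_solved_at r d P adv (Suc m) \<le> \<rho> ^ m / (4 ^ (n div 2) * \<rho> ^ ((n - 1) * \<alpha>))" (is "_ \<le> ?B")
proof -
  let ?E = "{h. solved_at d adv (\<lambda>i. h ! (i - 1)) (Suc m)}"
  have B: "0 \<le> ?B" using \<rho>_ge_1 by simp
  \<comment> \<open>Being solved at time \<open>Suc m\<close> is read off
    \<open>covered_start\<close> of the record \<open>c\<close> of slot \<open>Suc m\<close>, hence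
    depends only on the history \<open>h\<close> of the first \<open>m\<close> slots.\<close>
  have *: "indicator ?E (h @ [c]) \<le> ennreal ?B * ennreal (potential h)"
    if h: "h \<in> set_pmf (run_pmf r P adv m)" and c: "c \<in> set_pmf (slot_pmf r P adv h)" for h c
  proof (cases "h @ [c] \<in> ?E")
    case True
    have wf: "well_formed h" "length h = m" using run_well_formed[OF h] by auto
    have "h @ [c] \<in> set_pmf (run_pmf r P adv (Suc m))"
      using h c by auto
    from run_first_slot[OF this] have "targets d adv (\<lambda>i. (h @ [c]) ! (i - 1)) = {..<n}"
      by (intro targets_adv) simp_all
    then have "{..<n} \<subseteq> {..<level h}"
      using True slot_step(6)[OF wf(1) c] wf(2) by (simp add: solved_at_def nth_append)
    then have lev: "level h = n"
      using wf(1) n by (auto simp: well_formed_def)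
    have "1 \<le> \<rho> ^ min (idle_time h) \<alpha>"
      using \<rho>_ge_1 by simp
    also have "\<dots> = ?B * potential h"
    proof -
      have "n - (n + 1) div 2 = n div 2" by presburger
      then show ?thesis
        using \<rho>_ge_1 by (simp add: potential_def lev wf(2) power_add)
    qed
    finally show ?thesis
      using True B potential_pos[of h] by (simp flip: ennreal_mult add: less_imp_le)
  qed simp
  have "ennreal (prob_solved_at r d P adv (Suc m)) = emeasure (run_pmf r P adv (Suc m)) ?E"
    by (simp add: prob_solved_at_def measure_pmf.emeasure_eq_measure)
  also have "\<dots> = (\<integral>\<^sup>+ h. indicator ?E h \<partial>run_pmf r P adv (Suc m))"
    by (rule nn_integral_indicator[symmetric]) simp
  also have "\<dots> = (\<integral>\<^sup>+ h. \<integral>\<^sup>+ c. indicator ?E (h @ [c]) \<partial>slot_pmf r P adv h \<partial>run_pmf r P adv m)"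
    unfolding run_pmf.simps nn_integral_bind_pmf nn_integral_map_pmf by (rule refl)
  also have "\<dots> \<le> (\<integral>\<^sup>+ h. \<integral>\<^sup>+ c. ennreal ?B * ennreal (potential h) \<partial>slot_pmf r P adv h
      \<partial>run_pmf r P adv m)"
    using * by (intro nn_integral_mono_AE AE_pmfI) blast
  also have "\<dots> = ennreal ?B * (\<integral>\<^sup>+ h. ennreal (potential h) \<partial>run_pmf r P adv m)"
    by (simp add: nn_integral_cmult)
  also have "\<dots> \<le> ennreal ?B"
    using potential_run[of m] by (metis mult.right_neutral mult_left_mono zero_le)
  finally show ?thesis
    using B by (simp add: ennreal_le_iff)
qed

text \<open>The constant 96 makes \<open>3 * \<theta> * N = n / 4\<close>, so the slots with contact
  contribute at most \<open>exp (n / 4)\<close>, which \<open>4 ^ (n div 2)\<close> outweighs. The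
  term \<open>\<alpha> * n / 2\<close> is absorbed by the \<open>(n - 1) * \<alpha>\<close> idle
  slots.\<close>

lemma bound_less:
  assumes "real m < real \<alpha> * real n / 2 + (real n)\<^sup>2 / (96 * ln (real n / 2))"
  shows "\<rho> ^ m / (4 ^ (n div 2) * \<rho> ^ ((n - 1) * \<alpha>)) < 2 powr (- (real n / 2))"
proof -
  define N where "N = (real n)\<^sup>2 / (96 * ln (real n / 2))"
  have ln_pos: "ln (real n / 2) > 0" using n by simp
  have N: "0 \<le> N" "3 * \<theta> * N = real n / 4"
    using ln_pos n by (auto simp: N_def \<theta>_def field_simps power2_eq_square)
  have "real \<alpha> * real n / 2 \<le> real ((n - 1) * \<alpha>)"
  proof -
    have "real n / 2 \<le> real (n - 1)" using n by linarith
    from mult_right_mono[OF this, of "real \<alpha>"] show ?thesis by (simp add: mult_ac)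
  qed
  then have m: "real m \<le> N + real ((n - 1) * \<alpha>)"
    using assms by (simp add: N_def)
  have "\<rho> ^ m = \<rho> powr real m"
    using \<rho>_ge_1 by (simp add: powr_realpow)
  also have "\<dots> \<le> \<rho> powr (N + real ((n - 1) * \<alpha>))"
    using m \<rho>_ge_1 by (rule powr_mono)
  also have "\<dots> = \<rho> powr N * \<rho> ^ ((n - 1) * \<alpha>)"
    using \<rho>_ge_1 by (simp only: powr_add powr_realpow)
  also have "\<dots> \<le> exp (real n / 4) * \<rho> ^ ((n - 1) * \<alpha>)"
  proof -
    have "\<rho> powr N \<le> exp (3 * \<theta>) powr N"
      using N(1) \<rho>_ge_1 exp_ge_add_one_self[of "3 * \<theta>"] by (intro powr_mono2) (auto simp: \<rho>_def)
    also have "\<dots> = exp (real n / 4)"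
      using N(2) by (simp add: powr_def mult_ac)
    finally show ?thesis
      using \<rho>_ge_1 by (intro mult_right_mono) auto
  qed
  finally have "\<rho> ^ m / (4 ^ (n div 2) * \<rho> ^ ((n - 1) * \<alpha>)) \<le> exp (real n / 4) / 4 ^ (n div 2)"
    using \<rho>_ge_1 by (simp add: divide_simps mult_ac)
  also have "\<dots> \<le> exp (real n / 4) / 2 ^ (n - 1)"
  proof -
    \<comment> \<open>For odd \<open>n\<close> the rounding in \<open>n div 2\<close> loses a factor
      2.\<close>
    have "(2::real) ^ (n - 1) \<le> 2 ^ (2 * (n div 2))"
      by (intro power_increasing) auto
    also have "\<dots> = 4 ^ (n div 2)" by (simp add: power_mult)
    finally show ?thesis by (intro divide_left_mono) auto
  qed
  also have "\<dots> = exp (real n / 4 - real (n - 1) * ln 2)"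
    by (simp add: exp_diff exp_of_nat_mult)
  also have "\<dots> < exp (- (real n / 2) * ln 2)"
  proof -
    \<comment> \<open>\<open>ln 2 \<ge> 2 / 3\<close> reduces the claim to
      \<open>n / 4 < n / 3 - 2 / 3\<close>.\<close>
    have "(real n / 2 - 1) * (2 / 3) \<le> (real n / 2 - 1) * ln 2"
      using n ln2_ge_two_thirds by (intro mult_left_mono) auto
    then show ?thesis
      using n by (simp add: of_nat_diff algebra_simps)
  qed
  also have "\<dots> = 2 powr (- (real n / 2))"
    by (simp add: powr_def)
  finally show ?thesis .
qed

end

theorem theorem9:
  fixes n \<alpha> \<beta> :: nat and r d Vmax :: real and P :: "('s, 'm) protocol"
  assumes "n > 24" and "r > 0" and "d > r" and "\<beta> > 0"
    and "ereal Vmax > speed_threshold r \<alpha>"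
    and "conditional_protocol n r d Vmax \<alpha> \<beta> P"
    and "fair_protocol n r d Vmax \<alpha> \<beta> P"
  shows "\<exists>adv :: 's adversary. connected_MANET n r d Vmax \<alpha> \<beta> P adv \<and>
    (\<forall>t\<^sub>2\<ge>t_one adv. prob_solved_at r d P adv t\<^sub>2 \<ge> 2 powr (- (real n / 2)) \<longrightarrow>
       real (t\<^sub>2 - t_one adv) \<ge> real \<alpha> * real n / 2 + (real n)^2 / (96 * ln (real n / 2)))"
proof -
  \<comment> \<open>For \<open>\<alpha> = 0\<close> the threshold is infinite and no real speed
    exceeds it.\<close>
  have alpha: "\<alpha> \<ge> 1"
    using assms(5) by (cases "\<alpha> = 0") (auto simp: speed_threshold_def)
  then have "pi * r / (6 * real \<alpha>) < Vmax"
    using assms(5) by (simp add: speed_threshold_def)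
  \<comment> \<open>Since \<open>pi > 3\<close>, the threshold allows a walk of length
    \<open>r / 2\<close> in \<open>\<alpha>\<close> slots.\<close>
  moreover have "r / (2 * real \<alpha>) \<le> pi * r / (6 * real \<alpha>)"
    using alpha pi_gt3 assms(2) by (simp add: divide_simps)
  moreover have "0 < r / (2 * real \<alpha>)"
    using alpha assms(2) by simp
  ultimately have V: "r / (2 * real \<alpha>) \<le> Vmax" "0 < Vmax"
    by linarith+
  define \<epsilon> where "\<epsilon> = min (r / 4) (min ((d - r) / 2) (Vmax / 2))"
  interpret one_by_one_adversary n \<alpha> \<beta> r d Vmax \<epsilon> P
    by unfold_locales (use assms alpha V in \<open>auto simp: \<epsilon>_def min_def field_simps\<close>)
  show ?thesis
  proof (intro exI[of _ adv] conjI allI impI)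
    show "connected_MANET n r d Vmax \<alpha> \<beta> P adv"
      using legal connected by (simp add: connected_MANET_def)
    fix t\<^sub>2 assume "t_one adv \<le> t\<^sub>2" and prob: "2 powr (- (real n / 2)) \<le> prob_solved_at r d P adv t\<^sub>2"
    then obtain m where m: "t\<^sub>2 = Suc m"
      by (cases t\<^sub>2) auto
    have "\<not> real m < real \<alpha> * real n / 2 + (real n)\<^sup>2 / (96 * ln (real n / 2))"
      using bound_less[of m] prob_solved_le[of m] prob unfolding m by linarith
    then show "real \<alpha> * real n / 2 + (real n)\<^sup>2 / (96 * ln (real n / 2)) \<le> real (t\<^sub>2 - t_one adv)"
      by (simp add: m)
  qed
qed

end
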